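(* Let $d\ge 1$ and $n\ge 1$ be integers, and let $\mathcal{P}_0,\mathcal{P}_1,\ldots,\mathcal{P}_n\subset\mathbb{R}^d$ be polytopes. Suppose that all $\mathcal{P}_i$, $i\in\{0,1,\ldots,n\}$, are nonempty and that $\mathcal{P}_0$ is full dimensional. Then for every $j\in\{1,\ldots,n\}$, the inequality $z_j\ge 0$ describes a facet of $$\mathcal{D}:=\operatorname{conv}\left(\bigcup_{i=0}^n\left\{\begin{pmatrix}x\\ \mathbf{e}_i\end{pmatrix} : x\in\mathcal{P}_i\right\}\right)\subset\mathbb{R}^{d+n}.$$
   Context: $\mathbf{e}_i$ denotes the $i$-th standard unit vector of $\mathbb{R}^n$ for $i\in\{1,\ldots,n\}$, and $\mathbf{e}_0$ denotes the zero vector of $\mathbb{R}^n$. Points of $\mathbb{R}^{d+n}$ are written $\begin{pmatrix}x\\ z\end{pmatrix}$ with $x\in\mathbb{R}^d$, $z=(z_1,\ldots,z_n)^\top\in\mathbb{R}^n$. The face described by an inequality valid for a polytope is the set of points of the polytope satisfying it with equality. The dimension of a polytope is one less than the maximum number of affinely independent points in it; a polytope in $\mathbb{R}^m$ is full dimensional if its dimension is $m$; a facet is a face of dimension one less than that of the polytope. *)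

theory Defs
  imports "HOL-Analysis.Analysis"
begin

text \<open>
  \<open>\<real>\<^sup>d\<close> and \<open>\<real>\<^sup>n\<close> are \<^typ>\<open>real^'d\<close> and \<^typ>\<open>real^'n\<close>, and \<open>\<real>\<^bsup>d+n\<^esup>\<close> is the Euclidean product space
  \<^typ>\<open>(real^'d) \<times> (real^'n)\<close>. The index set \<open>{0,1,\<dots>,n}\<close> is \<^typ>\<open>'n option\<close>,
  with \<^term>\<open>None\<close> playing the role of \<open>0\<close>.
\<close>

definition unit_vec0 :: "'n::finite option \<Rightarrow> real^'n" where
  "unit_vec0 i = (case i of None \<Rightarrow> 0 | Some k \<Rightarrow> axis k 1)"

definition embedding_hull ::
    "('n::finite option \<Rightarrow> (real^'d) set) \<Rightarrow> ((real^'d) \<times> (real^'n)) set" where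
  "embedding_hull P = convex hull (\<Union>i. {(x, unit_vec0 i) |x. x \<in> P i})"

text \<open>
  An inequality describes a facet of \<open>S\<close> if it is valid on \<open>S\<close> and its equality set in \<open>S\<close>
  is a facet. For a linear inequality valid on \<open>S\<close>, the equality set is automatically a face
  in the sense of \<^const>\<open>face_of\<close> when \<open>S\<close> is convex, so beyond the dimension condition
  \<^const>\<open>facet_of\<close> only adds that the set is nonempty.
\<close>

definition ineq_ge_describes_facet ::
    "('a::euclidean_space \<Rightarrow> real) \<Rightarrow> real \<Rightarrow> 'a set \<Rightarrow> bool" where
  "ineq_ge_describes_facet f b S \<longleftrightarrow>
     (\<forall>p\<in>S. f p \<ge> b) \<and> {p \<in> S. f p = b} facet_of S"

end

theory Submission
  imports Defs
begin

text \<open>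
  The coordinate \<open>z\<^sub>j\<close> is nonnegative on all the points \<open>(x, e\<^sub>i)\<close>, hence on their convex
  hull, so its zero set cuts out a face \<open>F\<close>. The content is the dimension of \<open>F\<close>. Since
  \<open>P\<^sub>0\<close> is full dimensional, the affine hull of \<open>P\<^sub>0 \<times> {0} \<subseteq> F\<close> consists of all points \<open>(x, 0)\<close>.
  In particular it contains the origin, so the affine hull of \<open>F\<close> is a linear subspace. For
  each \<open>k \<noteq> j\<close> the face also contains some \<open>(p, e\<^sub>k)\<close> with \<open>p \<in> P\<^sub>k\<close>, and subtracting
  \<open>(p, 0)\<close> shows that \<open>(0, e\<^sub>k)\<close> lies in that subspace. The vectors \<open>(x, 0)\<close> and \<open>(0, e\<^sub>k)\<close>
  span the hyperplane \<open>z\<^sub>j = 0\<close> (lemma \<open>subspace_contains_supported\<close>), so the affine hull of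
  \<open>F\<close> is this hyperplane, and \<open>F\<close> has codimension one in the ambient space. Finally a point
  \<open>(p, e\<^sub>j)\<close> with \<open>p \<in> P\<^sub>j\<close> lies off the hyperplane, so the convex hull has a larger
  dimension than \<open>F\<close>, and must be full dimensional.
\<close>

lemma lifted_point_in_embedding_hull:
  assumes "x \<in> P i"
  shows "(x, unit_vec0 i) \<in> embedding_hull P"
  unfolding embedding_hull_def using assms by (intro hull_inc) blast

text \<open>
  A closed half-space is convex, so only the generators \<open>(x, e\<^sub>i)\<close> have to be tested.
\<close>
lemma embedding_hull_nonneg:
  fixes P :: "'n::finite option \<Rightarrow> (real^'d::finite) set"
  assumes "(x, z) \<in> embedding_hull P"
  shows "0 \<le> z $ j"
proof -
  have half: "{p :: (real^'d) \<times> (real^'n). 0 \<le> snd p $ j} = {p. (0, axis j 1) \<bullet> p \<ge> 0}"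
    by (auto simp: inner_prod_def inner_axis')
  have "embedding_hull P \<subseteq> {p. 0 \<le> snd p $ j}"
    unfolding embedding_hull_def
  proof (rule hull_minimal)
    show "convex {p :: (real^'d) \<times> (real^'n). 0 \<le> snd p $ j}"
      unfolding half by (rule convex_halfspace_ge)
  qed (auto simp: unit_vec0_def axis_def split: option.splits)
  with assms show ?thesis by auto
qed

text \<open>
  The base points \<open>p k\<close> are arbitrary: since all \<open>(x, 0)\<close> are available, the first component
  of \<open>(p k, e\<^sub>k)\<close> can be cancelled.
\<close>
lemma subspace_contains_supported:
  fixes A :: "('a::real_vector \<times> (real^'n)) set"
  assumes A: "subspace A"
    and base: "\<And>x. (x, 0) \<in> A"
    and unit: "\<And>k. k \<in> K \<Longrightarrow> (p k, axis k 1) \<in> A"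
    and supp: "\<And>k. k \<notin> K \<Longrightarrow> z $ k = 0"
  shows "(x, z) \<in> A"
proof -
  have "(0, axis k 1) \<in> A" if "k \<in> K" for k
    using subspace_diff[OF A unit[OF that] base[of "p k"]] by simp
  then have "(z $ k) *\<^sub>R (0, axis k 1) \<in> A" for k
    using subspace_scale[OF A, of "(0, axis k 1)" "z $ k"] base[of 0] supp[of k]
    by (cases "k \<in> K") auto
  then have "(\<Sum>k\<in>UNIV. (z $ k) *\<^sub>R (0, axis k 1)) \<in> A"
    by (intro subspace_sum[OF A])
  moreover have "(\<Sum>k\<in>UNIV. (z $ k) *\<^sub>R ((0::'a), axis k (1::real))) = (0, z)"
    by (simp add: prod_eq_iff fst_sum snd_sum vec_eq_iff axis_def if_distrib cong: if_cong)
  ultimately show ?thesis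
    using subspace_add[OF A base[of x], of "(0, z)"] by simp
qed

text \<open>
  The set of \<open>x\<close> for which \<open>(x, 0)\<close> lies in the affine hull is affine and contains the full
  dimensional \<open>P None\<close>, so it is the whole space. This puts the origin into the affine hull and
  reduces the claim to a statement about linear spans.
\<close>
lemma hyperplane_subset_affine_hull_zero_face:
  fixes P :: "'n::finite option \<Rightarrow> (real^'d::finite) set"
  assumes nonempty: "\<And>i. P i \<noteq> {}"
    and full: "aff_dim (P None) = int CARD('d)"
  shows "{p. snd p $ j = 0} \<subseteq> affine hull {p \<in> embedding_hull P. snd p $ j = 0}"
    (is "_ \<subseteq> ?A")
proof -
  have lift: "(x, unit_vec0 i) \<in> ?A" if "x \<in> P i" "i \<noteq> Some j" for x i
    using lifted_point_in_embedding_hull[of x P i] that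
    by (intro hull_inc) (auto simp: unit_vec0_def axis_def split: option.splits)
  have base: "(x, 0) \<in> ?A" for x
  proof -
    have "affine {x. (x, 0) \<in> ?A}"
    proof (rule affine_def[THEN iffD2], intro ballI allI impI)
      fix x y and u v :: real
      assume "x \<in> {x. (x, 0) \<in> ?A}" "y \<in> {x. (x, 0) \<in> ?A}" "u + v = 1"
      then show "u *\<^sub>R x + v *\<^sub>R y \<in> {x. (x, 0) \<in> ?A}"
        using mem_affine[OF affine_affine_hull, of "(x, 0)" _ "(y, 0)" u v] by simp
    qed
    moreover have "P None \<subseteq> {x. (x, 0) \<in> ?A}"
      using lift[of _ None] by (auto simp: unit_vec0_def)
    ultimately have "affine hull P None \<subseteq> {x. (x, 0) \<in> ?A}"
      by (rule hull_minimal[rotated])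
    moreover have "affine hull P None = UNIV"
      using full aff_dim_eq_full[of "P None"] by simp
    ultimately show ?thesis by auto
  qed
  have "0 \<in> ?A" using base[of 0] by (simp add: zero_prod_def)
  then have sub: "subspace ?A" by (simp add: subspace_affine)
  define p where "p i = (SOME x. x \<in> P i)" for i
  have p: "p i \<in> P i" for i
    using nonempty by (simp add: p_def some_in_eq)
  have unit: "(p (Some k), axis k 1) \<in> ?A" if "k \<in> - {j}" for k
    using lift[OF p, of "Some k"] that by (simp add: unit_vec0_def)
  show ?thesis
  proof
    fix q :: "(real^'d) \<times> (real^'n)"
    assume "q \<in> {p. snd p $ j = 0}"
    then have "(fst q, snd q) \<in> ?A"
      using subspace_contains_supported[OF sub base, of "- {j}" "\<lambda>k. p (Some k)" "snd q" "fst q"] unit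
      by simp
    then show "q \<in> ?A" by simp
  qed
qed

theorem theorem4:
  fixes P :: "'n::finite option \<Rightarrow> (real^'d::finite) set"
    and j :: 'n
  assumes "\<And>i. polytope (P i)"
    and "\<And>i. P i \<noteq> {}"
    and "aff_dim (P None) = int CARD('d)"
  shows "ineq_ge_describes_facet (\<lambda>(x, z). z $ j) 0 (embedding_hull P)"
proof -
  define F where "F = {p \<in> embedding_hull P. snd p $ j = 0}"
  define H where "H = {p :: (real^'d) \<times> (real^'n). snd p $ j = 0}"
  have H: "H = {p. (0, axis j 1) \<bullet> p = 0}"
    by (auto simp: H_def inner_prod_def inner_axis')
  have affF: "affine hull F = H"
  proof
    show "affine hull F \<subseteq> H"
    proof (rule hull_minimal)
      show "F \<subseteq> H"
        by (auto simp: F_def H_def)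
      show "affine H"
        unfolding H by (rule affine_hyperplane)
    qed
    show "H \<subseteq> affine hull F"
      unfolding F_def H_def using hyperplane_subset_affine_hull_zero_face[of P] assms(2,3) by simp
  qed
  have F_eq: "F = embedding_hull P \<inter> {p. (0, axis j 1) \<bullet> p = 0}"
    unfolding F_def H[symmetric] H_def by blast
  have face: "F face_of embedding_hull P"
    unfolding F_eq
  proof (rule face_of_Int_supporting_hyperplane_ge)
    show "convex (embedding_hull P)"
      by (simp add: embedding_hull_def)
    show "(0, axis j 1) \<bullet> p \<ge> 0" if "p \<in> embedding_hull P" for p
      using embedding_hull_nonneg[of "fst p" "snd p" P j] that
      by (simp add: inner_prod_def inner_axis')
  qed
  have dimF: "aff_dim F = int DIM((real^'d) \<times> (real^'n)) - 1"
  proof -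
    have "aff_dim F = aff_dim H"
      by (simp flip: affF)
    also have "\<dots> = int DIM((real^'d) \<times> (real^'n)) - 1"
      unfolding H using DIM_positive[where 'a = "(real^'d) \<times> (real^'n)"]
      by (subst aff_dim_hyperplane) (simp add: zero_prod_def, linarith)
    finally show ?thesis .
  qed
  have dimD: "aff_dim (embedding_hull P) = aff_dim F + 1"
  proof (rule antisym)
    show "aff_dim (embedding_hull P) \<le> aff_dim F + 1"
      unfolding dimF using aff_dim_le_DIM[of "embedding_hull P"] by simp
    obtain q where q: "q \<in> P (Some j)"
      using assms(2) by blast
    have "(q, unit_vec0 (Some j)) \<notin> affine hull F"
      by (simp add: affF H_def unit_vec0_def)
    then have "aff_dim F + 1 = aff_dim (insert (q, unit_vec0 (Some j)) F)"
      by (simp add: aff_dim_insert)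
    also have "\<dots> \<le> aff_dim (embedding_hull P)"
      using lifted_point_in_embedding_hull[of q P, OF q]
      by (intro aff_dim_subset) (auto simp: F_def)
    finally show "aff_dim F + 1 \<le> aff_dim (embedding_hull P)" .
  qed
  have "F \<noteq> {}"
  proof
    assume "F = {}"
    with affF have "H = {}" by simp
    moreover have "0 \<in> H" by (simp add: H_def)
    ultimately show False by simp
  qed
  with face dimD have "F facet_of embedding_hull P"
    by (simp add: facet_of_def)
  then show ?thesis
    using embedding_hull_nonneg[of _ _ P j]
    by (auto simp: ineq_ge_describes_facet_def F_def case_prod_unfold)
qed

end
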